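(* Let $G=(V,A)$ be a two-way directed graph with centroid set $B\subseteq V$ and known turning ratios, let $M\subseteq V$ be a set of monitored vertices, and let the flow calculation matrix $\mathbf{F}$ be partitioned into blocks $\mathbf{F}^i$ corresponding to the unmonitored components $G'_i$. For each unmonitored component $G'_i$, let $C_i$ be a minimum vertex cut between $(B-M)_i$ and $A(M)_i$. If $G'_i$ is a tree, then $\operatorname{rank}(\mathbf{F}^i)$ equals the number of columns of $\mathbf{F}^i$ (that is, the flow on block $i$ is calculable) if and only if $|C_i|=|(B-M)_i|$.
   Context: A two-way directed graph is a finite directed graph $G=(V,A)$ without loops or parallel arcs such that $uv\in A$ implies $vu\in A$. Such a graph is called a tree (or connected) when the underlying undirected graph, obtained by replacing each pair $uv,vu$ by one edge, is a tree (or connected). $B\subseteq V$ is the set of centroids (vertices at which an unknown balancing flow may enter or leave the network) and $M\subseteq V$ is the set of monitored vertices. Turning factors: each arc $vu$ has a positive turning ratio $c_{vu}$ (the fraction of the traffic entering $v$ that leaves along $vu$). For each vertex $v$ an outgoing arc $e_v=vw$ is fixed as its canonical arc, and $\alpha_{vu}=c_{vu}/c_{vw}$ for every outgoing arc $vu$ of $v$. $A(M)$ is the set of vertices in $V\setminus M$ adjacent to at least one vertex of $M$. The combined cutset $C_M$ is the set of arcs of the subgraph of $G$ induced by $M\cup A(M)$. The unmonitored subgraph is $G'=(V\setminus M, A\setminus C_M)$; its connected components $G'_1,G'_2,\dots$ are the unmonitored components. For each $i$, $(B-M)_i$ and $A(M)_i$ denote the sets of vertices of $G'_i$ lying in $B\setminus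 M$ and in $A(M)$, respectively. Flow calculation matrix $\mathbf{F}$: its rows are indexed by $V\setminus M$ (flow conservation at each unmonitored vertex). Its columns are of two kinds: one "canonical arc" column for each $v\in V\setminus(M\cup A(M))$, and one "balancing flow" column for each $b\in B\setminus M$. The entry in row $u$ and canonical arc column $v$ is $\alpha_{vu}$ if $vu\in A$, is $-\sum_{w:\,vw\in A}\alpha_{vw}$ if $u=v$ (the sum being over all neighbors of $v$ in $G$), and is $0$ otherwise. The entry in row $u$ and balancing flow column $b$ is $1$ if $u=b$ and $0$ otherwise. The block $\mathbf{F}^i$ is the submatrix with rows indexed by the vertices of $G'_i$ and columns corresponding to the vertices of $G'_i$ (canonical arc columns for vertices of $G'_i$ not in $A(M)$, balancing flow columns for vertices in $(B-M)_i$). The flow on block $i$ is calculable when the unknown canonical arc flows and balancing flows of that block are uniquely determined by the linear system with coefficient matrix $\mathbf{F}^i$, i.e. when $\mathbf{F}^i$ has full column rank. A matrix with no columns has rank $0$. A vertex cut between vertex sets $X$ and $Y$ in $G'_i$ is a set of vertices of $G'_i$ (possibly including vertices of $X\cup Y$) meeting every path of $G'_i$ from $X$ to $Y$, including one-vertex paths; minimum means of minimum cardinality. It is empty if $X$ or $Y$ is empty.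
   Formalization: The formal theorem assumes in addition that (B−M)_i and A(M)_i are not both empty; if both are empty, the columns of F^i sum to zero, so the rank is deficient although |C_i| = 0 = |(B−M)_i|, and the claim is false. *)

theory Defs
  imports
    "Graph_Theory.Graph_Theory"
    "Jordan_Normal_Form.DL_Rank"
    "Jordan_Normal_Form.DL_Submatrix"
begin

text \<open>
  A two-way directed graph is a finite symmetric digraph without loops and parallel arcs, i.e. an
  instance of the locale \<^locale>\<open>pair_graph\<close>.  The predicate \<^const>\<open>Digraph_Component.tree\<close> does not fit
  such graphs: it forbids every directed cycle, hence also the closed walk along an arc and its
  reverse.  A cycle of the underlying simple undirected graph is a directed cycle with at least
  three arcs.
\<close>

definition two_way_tree :: "'a pair_pre_digraph \<Rightarrow> bool" where
  "two_way_tree G \<longleftrightarrow>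
     Digraph_Component.connected (with_proj G) \<and>
     \<not> (\<exists>p. pre_digraph.cycle (with_proj G) p \<and> 3 \<le> length p)"

definition connected_component :: "'a pair_pre_digraph \<Rightarrow> 'a pair_pre_digraph \<Rightarrow> bool" where
  "connected_component G H \<longleftrightarrow>
     pre_digraph.max_subgraph (with_proj G) Digraph_Component.connected (with_proj H)"


subsection \<open>Monitored vertices\<close>

definition adjacent_to :: "'a pair_pre_digraph \<Rightarrow> 'a set \<Rightarrow> 'a set" where
  "adjacent_to G M = {v \<in> pverts G - M. \<exists>m \<in> M. (m, v) \<in> parcs G}"

definition combined_cutset :: "'a pair_pre_digraph \<Rightarrow> 'a set \<Rightarrow> ('a \<times> 'a) set" where
  "combined_cutset G M = arcs (with_proj G \<restriction> (M \<union> adjacent_to G M))"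

definition unmonitored_subgraph :: "'a pair_pre_digraph \<Rightarrow> 'a set \<Rightarrow> 'a pair_pre_digraph" where
  "unmonitored_subgraph G M =
     \<lparr> pverts = pverts G - M, parcs = parcs G - combined_cutset G M \<rparr>"


subsection \<open>The flow calculation matrix\<close>

text \<open>
  \<open>c (v, u)\<close> is the turning ratio of the arc \<open>vu\<close> and \<open>e v\<close> is the canonical arc of \<open>v\<close>.
\<close>

definition turning_factor :: "('a \<times> 'a \<Rightarrow> real) \<Rightarrow> ('a \<Rightarrow> 'a \<times> 'a) \<Rightarrow> 'a \<Rightarrow> 'a \<Rightarrow> real" where
  "turning_factor c e v u = c (v, u) / c (e v)"

datatype 'a flow_column = Canonical (col_vertex: 'a) | Balancing (col_vertex: 'a)

definition flow_columns :: "'a pair_pre_digraph \<Rightarrow> 'a set \<Rightarrow> 'a set \<Rightarrow> 'a flow_column set" where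
  "flow_columns G B M =
     Canonical ` (pverts G - (M \<union> adjacent_to G M)) \<union> Balancing ` (B - M)"

fun flow_entry ::
  "'a pair_pre_digraph \<Rightarrow> ('a \<times> 'a \<Rightarrow> real) \<Rightarrow> ('a \<Rightarrow> 'a \<times> 'a) \<Rightarrow> 'a \<Rightarrow> 'a flow_column \<Rightarrow> real"
where
  "flow_entry G c e u (Canonical v) =
     (if (v, u) \<in> parcs G then turning_factor c e v u
      else if u = v then - (\<Sum>w | (v, w) \<in> parcs G. turning_factor c e v w)
      else 0)"
| "flow_entry G c e u (Balancing b) = (if u = b then 1 else 0)"

text \<open>
  Library matrices are indexed by natural numbers, so the rows and columns are listed in some order:
  \<open>rs\<close> enumerates the unmonitored vertices and \<open>cs\<close> the members of \<^const>\<open>flow_columns\<close>.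
\<close>

definition flow_matrix ::
  "'a pair_pre_digraph \<Rightarrow> ('a \<times> 'a \<Rightarrow> real) \<Rightarrow> ('a \<Rightarrow> 'a \<times> 'a) \<Rightarrow>
   'a list \<Rightarrow> 'a flow_column list \<Rightarrow> real mat"
where
  "flow_matrix G c e rs cs =
     mat (length rs) (length cs) (\<lambda>(i, j). flow_entry G c e (rs ! i) (cs ! j))"

definition flow_block ::
  "'a pair_pre_digraph \<Rightarrow> ('a \<times> 'a \<Rightarrow> real) \<Rightarrow> ('a \<Rightarrow> 'a \<times> 'a) \<Rightarrow>
   'a list \<Rightarrow> 'a flow_column list \<Rightarrow> 'a pair_pre_digraph \<Rightarrow> real mat"
where
  "flow_block G c e rs cs H =
     submatrix (flow_matrix G c e rs cs)
       {i. i < length rs \<and> rs ! i \<in> pverts H}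
       {j. j < length cs \<and> col_vertex (cs ! j) \<in> pverts H}"

definition mat_rank :: "'a::field mat \<Rightarrow> nat" where
  "mat_rank A = vec_space.rank (dim_row A) A"


subsection \<open>Vertex cuts\<close>

definition vertex_cut :: "'a pair_pre_digraph \<Rightarrow> 'a set \<Rightarrow> 'a set \<Rightarrow> 'a set \<Rightarrow> bool" where
  "vertex_cut H X Y S \<longleftrightarrow>
     S \<subseteq> pverts H \<and>
     (\<forall>p. vpath p (with_proj H) \<and> hd p \<in> X \<and> last p \<in> Y \<longrightarrow> set p \<inter> S \<noteq> {})"

definition minimum_vertex_cut :: "'a pair_pre_digraph \<Rightarrow> 'a set \<Rightarrow> 'a set \<Rightarrow> 'a set \<Rightarrow> bool" where
  "minimum_vertex_cut H X Y S \<longleftrightarrow> is_arg_min card (vertex_cut H X Y) S"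

end

theory Submission
  imports Defs
begin

text \<open>
  Let \<open>V\<close> be the vertex set of the component, \<open>X\<close> its unmonitored centroids and \<open>Y\<close> its vertices
  in \<open>A(M)\<close>. Eliminating the balancing flows, the block has full column rank iff the weighted
  Laplacian with columns \<open>V - Y\<close> and rows \<open>V - X\<close> has trivial kernel. Since \<open>X\<close> is itself a vertex
  cut, \<open>card C = card X\<close> says that no cut is smaller than \<open>X\<close>, which is Hall's condition for the
  zero pattern of this matrix: \<open>card R \<le> card (N[R] - X)\<close> for all \<open>R \<subseteq> V - Y\<close>. Hall's condition is
  necessary by counting equations and unknowns. On a tree it is sufficient by elimination of a
  leaf \<open>v\<close> with neighbour \<open>u\<close>: depending on whether \<open>v\<close> lies in \<open>X\<close> or \<open>Y\<close>, one deletes \<open>v\<close>,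
  solves its equation for the unknown at \<open>v\<close>, moves \<open>u\<close> into \<open>Y\<close>, or moves \<open>u\<close> into \<open>X\<close>. Hall's
  condition and diagonal dominance of the columns survive each of these steps.
\<close>

section \<open>Linear algebra\<close>

text \<open>Gaussian elimination: an equation with a nonzero coefficient at \<open>k\<close> is
  solved for \<open>x k\<close> and substituted into the rest, which removes one equation and one
  unknown.\<close>

lemma homogeneous_system_nontrivial_solution:
  fixes a :: "'i \<Rightarrow> 'j \<Rightarrow> 'f::field"
  assumes "finite I" and "finite J" and "card I < card J"
  shows "\<exists>x. (\<exists>j\<in>J. x j \<noteq> 0) \<and> (\<forall>j. j \<notin> J \<longrightarrow> x j = 0) \<and> (\<forall>i\<in>I. (\<Sum>j\<in>J. a i j * x j) = 0)"
  using assms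
proof (induction I arbitrary: J a rule: finite_induct)
  case empty
  then obtain j where "j \<in> J" by fastforce
  thus ?case by (intro exI[of _ "\<lambda>k. if k = j then 1 else 0"]) auto
next
  case (insert i I)
  show ?case
  proof (cases "\<forall>j\<in>J. a i j = 0")
    case True
    have "card I < card J" using insert by simp
    from insert.IH[OF insert.prems(1) this, of a] obtain x
      where x: "\<exists>j\<in>J. x j \<noteq> 0" "\<forall>j. j \<notin> J \<longrightarrow> x j = 0" "\<forall>r\<in>I. (\<Sum>j\<in>J. a r j * x j) = 0"
      by auto
    moreover have "(\<Sum>j\<in>J. a i j * x j) = 0" using True by (simp add: sum.neutral)
    ultimately show ?thesis by (intro exI[of _ x]) simp
  next
    case False
    then obtain k where k: "k \<in> J" "a i k \<noteq> 0" by blast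
    let ?J = "J - {k}"
    have "card I < card ?J" using insert k by simp
    from insert.IH[OF _ this, of "\<lambda>r j. a r j - a r k * a i j / a i k"] insert.prems
    obtain x where x: "\<exists>j\<in>?J. x j \<noteq> 0" "\<forall>j. j \<notin> ?J \<longrightarrow> x j = 0"
      "\<forall>r\<in>I. (\<Sum>j\<in>?J. (a r j - a r k * a i j / a i k) * x j) = 0"
      by auto
    define y where "y = x(k := - (\<Sum>j\<in>?J. a i j * x j) / a i k)"
    have sum_y: "(\<Sum>j\<in>J. a r j * y j) = a r k * y k + (\<Sum>j\<in>?J. a r j * x j)" for r
      using insert.prems(1) k(1) by (simp add: sum.remove y_def)
    have "(\<Sum>j\<in>J. a r j * y j) = 0" if r: "r \<in> I" for r
    proof -
      have "(\<Sum>j\<in>?J. (a r j - a r k * a i j / a i k) * x j)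
          = (\<Sum>j\<in>?J. a r j * x j) - a r k / a i k * (\<Sum>j\<in>?J. a i j * x j)"
        unfolding sum_distrib_left sum_subtractf[symmetric]
        by (intro sum.cong) (simp_all add: left_diff_distrib)
      thus ?thesis using x(3) r sum_y[of r] by (simp add: y_def)
    qed
    moreover have "(\<Sum>j\<in>J. a i j * y j) = 0" using sum_y[of i] k(2) by (simp add: y_def)
    ultimately show ?thesis using x(1,2) k(1)
      by (intro exI[of _ y]) (auto simp: y_def)
  qed
qed

section \<open>Full column rank as a trivial kernel\<close>

lemma mat_rank_eq_dim_col_iff:
  fixes A :: "'f::field mat"
  shows "mat_rank A = dim_col A \<longleftrightarrow>
    (\<forall>v \<in> carrier_vec (dim_col A). A *\<^sub>v v = 0\<^sub>v (dim_row A) \<longrightarrow> v = 0\<^sub>v (dim_col A))"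
    (is "_ \<longleftrightarrow> ?trivial")
proof -
  interpret vec_space "TYPE('f)" "dim_row A" .
  have A: "A \<in> carrier_mat (dim_row A) (dim_col A)" by simp
  show ?thesis
  \<comment> \<open>Independence of \<open>set (cols A)\<close> ignores repetitions and so matches
    full rank only for distinct columns. A repeated column lowers the rank and makes a difference of
    unit vectors a kernel vector.\<close>
  proof (cases "distinct (cols A)")
    case True
    have "mat_rank A = dim_col A \<longleftrightarrow> lin_indpt (set (cols A))"
      unfolding mat_rank_def
      using full_rank_lin_indpt[OF A _ True] lin_indpt_full_rank[OF A True] by auto
    also have "\<dots> \<longleftrightarrow> ?trivial"
    proof
      assume "lin_indpt (set (cols A))"
      thus ?trivial using lin_depI[OF A _ _ _ True] by auto
    next
      assume triv: ?trivial
      show "lin_indpt (set (cols A))"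
      proof
        assume "lin_dep (set (cols A))"
        from lin_depE[OF A this True] triv show False by metis
      qed
    qed
    finally show ?thesis .
  next
    case False
    then obtain i j where ij: "i < dim_col A" "j < dim_col A" "i \<noteq> j" "col A i = col A j"
      by (auto simp: distinct_conv_nth)
    obtain S where S: "maximal S (\<lambda>T. T \<subseteq> set (cols A) \<and> lin_indpt T)"
      using maximal_exists_superset[of "set (cols A)" "\<lambda>T. T \<subseteq> set (cols A) \<and> lin_indpt T" "{}"]
        finite_lin_indpt2[of "{}"] by auto
    have "rank A \<le> card (set (cols A))"
      using rank_card_indpt[OF A S] S by (auto simp: maximal_def intro: card_mono)
    also have "\<dots> < dim_col A"
      using False card_length[of "cols A"] card_distinct[of "cols A"] by (metis cols_length le_neq_implies_less)
    finally have "mat_rank A \<noteq> dim_col A" by (simp add: mat_rank_def)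
    moreover have "\<not> ?trivial"
    proof
      assume triv: ?trivial
      let ?v = "unit_vec (dim_col A) i - unit_vec (dim_col A) j :: 'f vec"
      have "A *\<^sub>v unit_vec (dim_col A) k = col A k" if "k < dim_col A" for k
        by (rule eq_vecI) (use that in auto)
      hence "A *\<^sub>v ?v = col A i - col A j"
        using ij by (subst mult_minus_distrib_mat_vec[OF A]) auto
      hence "A *\<^sub>v ?v = 0\<^sub>v (dim_row A)" using ij by (auto simp: minus_cancel_vec)
      hence "?v = 0\<^sub>v (dim_col A)" using triv by auto
      hence "?v $ i = 0" using ij by simp
      thus False using ij by simp
    qed
    ultimately show ?thesis by blast
  qed
qed

text \<open>\<open>pick I\<close> lists \<open>I\<close> in increasing order; counting the smaller
  elements inverts it.\<close>

lemma bij_betw_pick: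
  assumes "finite I"
  shows "bij_betw (pick I) {..<card I} I"
proof -
  have inj: "inj_on (pick I) {..<card I}"
    by (rule inj_on_inverseI[of _ "\<lambda>x. card {a \<in> I. a < x}"]) (rule card_pick, simp)
  have "pick I ` {..<card I} \<subseteq> I"
    by (rule image_subsetI) (rule pick_in_set, simp)
  hence "pick I ` {..<card I} = I"
    by (rule card_subset_eq[OF assms]) (simp add: card_image[OF inj])
  with inj show ?thesis by (rule bij_betw_imageI)
qed

text \<open>Replaces vectors indexed by positions with functions \<open>z\<close> on column labels,
  so that the chosen enumerations disappear. Each label must own a single coordinate, hence
  \<open>distinct cs\<close>; repeated rows only repeat equations.\<close>

lemma submatrix_rank_eq_dim_col_iff:
  fixes f :: "'r \<Rightarrow> 'c \<Rightarrow> 'f::field" and rs cs P Q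
  assumes "distinct cs"
  defines "A \<equiv> submatrix (mat (length rs) (length cs) (\<lambda>(i, j). f (rs ! i) (cs ! j)))
                 {i. i < length rs \<and> P (rs ! i)} {j. j < length cs \<and> Q (cs ! j)}"
  shows "mat_rank A = dim_col A \<longleftrightarrow>
    (\<forall>z. (\<forall>r. r \<in> set rs \<and> P r \<longrightarrow> (\<Sum>k | k \<in> set cs \<and> Q k. f r k * z k) = 0) \<longrightarrow>
      (\<forall>k. k \<in> set cs \<and> Q k \<longrightarrow> z k = 0))"
proof -
  define I where "I = {i. i < length rs \<and> P (rs ! i)}"
  define J where "J = {j. j < length cs \<and> Q (cs ! j)}"
  define K where "K = {k. k \<in> set cs \<and> Q k}"
  have fin: "finite I" "finite J" by (simp_all add: I_def J_def)
  have eqs: "{i. i < length rs \<and> i \<in> I} = I" "{j. j < length cs \<and> j \<in> J} = J"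
    by (auto simp: I_def J_def)
  define row where "row i = rs ! pick I i" for i
  define col where "col j = cs ! pick J j" for j
  have A: "A = mat (card I) (card J) (\<lambda>(i, j). f (row i) (col j))"
  proof (rule eq_matI)
    fix i j assume "i < dim_row (mat (card I) (card J) (\<lambda>(i, j). f (row i) (col j)))"
      and "j < dim_col (mat (card I) (card J) (\<lambda>(i, j). f (row i) (col j)))"
    moreover from this have "pick I i \<in> I" "pick J j \<in> J" by (auto intro: pick_in_set)
    ultimately show "A $$ (i, j) = mat (card I) (card J) (\<lambda>(i, j). f (row i) (col j)) $$ (i, j)"
      unfolding A_def I_def[symmetric] J_def[symmetric]
      by (subst submatrix_index) (auto simp: eqs row_def col_def I_def J_def)
  qed (auto simp: A_def I_def[symmetric] J_def[symmetric] dim_submatrix eqs)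
  have rows: "row ` {..<card I} = {r. r \<in> set rs \<and> P r}"
  proof -
    have "row ` {..<card I} = (!) rs ` I"
      using bij_betw_imp_surj_on[OF bij_betw_pick[OF fin(1)]] by (auto simp: row_def image_image[symmetric])
    also have "\<dots> = {r. r \<in> set rs \<and> P r}" by (auto simp: I_def in_set_conv_nth)
    finally show ?thesis .
  qed
  have cols: "bij_betw col {..<card J} K"
  proof -
    have "bij_betw ((!) cs) J K"
      unfolding bij_betw_def using assms(1)
      by (auto simp: J_def K_def in_set_conv_nth inj_on_def nth_eq_iff_index_eq)
    from bij_betw_trans[OF bij_betw_pick[OF fin(2)] this]
    show ?thesis by (simp add: col_def[abs_def] o_def)
  qed
  define idx where "idx = the_inv_into {..<card J} col"
  have idx: "idx (col j) = j" if "j < card J" for j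
    using that cols by (auto simp: idx_def bij_betw_def the_inv_into_f_f)
  have col_idx: "idx k < card J" "col (idx k) = k" if "k \<in> K" for k
    using that cols idx by (auto simp: bij_betw_def)
  have mult: "A *\<^sub>v v = vec (card I) (\<lambda>i. \<Sum>k\<in>K. f (row i) k * v $ idx k)"
    if "v \<in> carrier_vec (card J)" for v
  proof (rule eq_vecI)
    fix i assume "i < dim_vec (vec (card I) (\<lambda>i. \<Sum>k\<in>K. f (row i) k * v $ idx k))"
    hence i: "i < card I" by simp
    have "(A *\<^sub>v v) $ i = (\<Sum>j<card J. f (row i) (col j) * v $ j)"
      using that i by (simp add: A scalar_prod_def atLeast0LessThan)
    also have "\<dots> = (\<Sum>j<card J. f (row i) (col j) * v $ idx (col j))"
      by (intro sum.cong) (simp_all add: idx)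
    also have "\<dots> = (\<Sum>k\<in>K. f (row i) k * v $ idx k)"
      using sum.reindex_bij_betw[OF cols, of "\<lambda>k. f (row i) k * v $ idx k"] by simp
    finally show "(A *\<^sub>v v) $ i = vec (card I) (\<lambda>i. \<Sum>k\<in>K. f (row i) k * v $ idx k) $ i"
      using i by simp
  qed (simp add: A)
  have kernel: "A *\<^sub>v v = 0\<^sub>v (card I) \<longleftrightarrow>
      (\<forall>r. r \<in> set rs \<and> P r \<longrightarrow> (\<Sum>k\<in>K. f r k * v $ idx k) = 0)"
    if "v \<in> carrier_vec (card J)" for v
  proof -
    have "A *\<^sub>v v = 0\<^sub>v (card I) \<longleftrightarrow> (\<forall>i<card I. (\<Sum>k\<in>K. f (row i) k * v $ idx k) = 0)"
      unfolding mult[OF that] by (auto simp: vec_eq_iff)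
    also have "\<dots> \<longleftrightarrow> (\<forall>r\<in>row ` {..<card I}. (\<Sum>k\<in>K. f r k * v $ idx k) = 0)" by auto
    finally show ?thesis unfolding rows by auto
  qed
  have dims: "dim_col A = card J" "dim_row A = card I" by (simp_all add: A)
  have "(\<forall>v\<in>carrier_vec (card J). A *\<^sub>v v = 0\<^sub>v (card I) \<longrightarrow> v = 0\<^sub>v (card J)) \<longleftrightarrow>
    (\<forall>z. (\<forall>r. r \<in> set rs \<and> P r \<longrightarrow> (\<Sum>k\<in>K. f r k * z k) = 0) \<longrightarrow> (\<forall>k\<in>K. z k = 0))"
  proof (intro iffI allI ballI impI)
    fix z k
    assume triv: "\<forall>v\<in>carrier_vec (card J). A *\<^sub>v v = 0\<^sub>v (card I) \<longrightarrow> v = 0\<^sub>v (card J)"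
      and z: "\<forall>r. r \<in> set rs \<and> P r \<longrightarrow> (\<Sum>k\<in>K. f r k * z k) = 0" and k: "k \<in> K"
    define v where "v = vec (card J) (\<lambda>j. z (col j))"
    have v: "v \<in> carrier_vec (card J)" by (simp add: v_def)
    have vz: "v $ idx k = z k" if "k \<in> K" for k using col_idx[OF that] by (simp add: v_def)
    have "v = 0\<^sub>v (card J)" using triv v z kernel[OF v] vz by (simp cong: sum.cong)
    thus "z k = 0" using vz[OF k] col_idx[OF k] by simp
  next
    fix v
    assume triv: "\<forall>z. (\<forall>r. r \<in> set rs \<and> P r \<longrightarrow> (\<Sum>k\<in>K. f r k * z k) = 0) \<longrightarrow>
        (\<forall>k\<in>K. z k = 0)"
      and v: "v \<in> carrier_vec (card J)" and "A *\<^sub>v v = 0\<^sub>v (card I)"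
    hence zero: "v $ idx k = 0" if "k \<in> K" for k
      using that kernel[OF v] spec[OF triv, of "\<lambda>k. v $ idx k"] by blast
    have "v $ j = 0" if "j < card J" for j
      using that idx[OF that] cols zero[of "col j"] by (auto simp: bij_betw_def)
    thus "v = 0\<^sub>v (card J)" using v by (intro eq_vecI) auto
  qed
  thus ?thesis using mat_rank_eq_dim_col_iff[of A] unfolding dims K_def by auto
qed


section \<open>Leaf elimination\<close>

text \<open>Trees grown by attaching leaves, each edge with both orientations; rule induction then
  removes one leaf at a time.\<close>

inductive leaf_tree :: "'a set \<Rightarrow> ('a \<times> 'a) set \<Rightarrow> bool" where
  single: "leaf_tree {v} {}"
| attach: "leaf_tree V E \<Longrightarrow> u \<in> V \<Longrightarrow> v \<notin> V \<Longrightarrow> leaf_tree (insert v V) ({(u, v), (v, u)} \<union> E)"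

lemma leaf_tree_wf:
  assumes "leaf_tree V E"
  shows "finite V" and "E \<subseteq> V \<times> V"
  using assms by (induction) auto

text \<open>
  For symmetric \<open>E\<close> this is Hall's condition for the bipartite graph joining a column \<open>v \<in> V - Y\<close>
  to the rows outside \<open>X\<close> in which the column may be nonzero.
\<close>

definition hall_condition :: "'a set \<Rightarrow> ('a \<times> 'a) set \<Rightarrow> 'a set \<Rightarrow> 'a set \<Rightarrow> bool" where
  "hall_condition V E X Y \<longleftrightarrow> (\<forall>R \<subseteq> V - Y. card R \<le> card ((R \<union> E `` R) - X))"

text \<open>
  Eliminating a leaf changes the diagonal entry of its neighbour, so the induction needs weakly
  diagonally dominant columns with an arbitrary diagonal \<open>- d\<close>; strictness somewhere replaces a
  vertex of \<open>Y\<close> that has been removed.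
\<close>

lemma leaf_tree_kernel_trivial:
  fixes a :: "'a \<Rightarrow> 'a \<Rightarrow> real" and d x :: "'a \<Rightarrow> real"
  assumes "leaf_tree V E"
    and "hall_condition V E X Y"
    and "\<And>v u. (v, u) \<in> E \<Longrightarrow> v \<notin> Y \<Longrightarrow> 0 < a v u"
    and "\<And>v. v \<in> V - Y \<Longrightarrow> (\<Sum>u\<in>E `` {v}. a v u) \<le> d v"
    and "V \<inter> Y \<noteq> {} \<or> (\<exists>v\<in>V. (\<Sum>u\<in>E `` {v}. a v u) < d v)"
    and "\<And>v. v \<in> V \<inter> Y \<Longrightarrow> x v = 0"
    and "\<And>u. u \<in> V - X \<Longrightarrow> (\<Sum>v\<in>E `` {u}. a v u * x v) = d u * x u"
  shows "\<forall>v\<in>V. x v = 0"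
  using assms
proof (induction arbitrary: X Y d rule: leaf_tree.induct)
  case (single v)
  show ?case
  proof (cases "v \<in> Y")
    case True
    thus ?thesis using single.prems(5) by simp
  next
    case False
    \<comment> \<open>Without edges the only row available to \<open>{v}\<close> is its own, so
      Hall's condition excludes \<open>v\<close> from \<open>X\<close>. As \<open>v\<close> is not
      in \<open>Y\<close>, the strictness hypothesis gives \<open>0 < d v\<close>.\<close>
    have "card {v} \<le> card ({v} \<union> {} `` {v} - X)"
      by (rule single.prems(1)[unfolded hall_condition_def, rule_format]) (simp add: False)
    hence "v \<notin> X" by auto
    hence "d v * x v = 0" using single.prems(6)[of v] by simp
    moreover have "0 < d v" using single.prems(4) False by simp
    ultimately show ?thesis by simp
  qed
next
  case (attach V E u v)
  let ?E = "{(u, v), (v, u)} \<union> E"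
  have fin: "finite V" and EV: "E \<subseteq> V \<times> V" using leaf_tree_wf[OF attach.hyps(1)] by auto
  have uv: "u \<noteq> v" using attach.hyps by blast
  have finE: "finite (E `` S)" for S
    by (rule finite_subset[OF _ fin]) (use EV in auto)
  have nbr_v: "?E `` {v} = {u}" and vE: "v \<notin> E `` S" for S using EV attach.hyps uv by auto
  have nbr_u: "?E `` {u} = insert v (E `` {u})" using uv by auto
  have nbr: "?E `` {w} = E `` {w}" if "w \<in> V" "w \<noteq> u" for w using that attach.hyps by auto
  have nbrs: "?E `` R = E `` R" if "R \<subseteq> V - {u}" for R using that attach.hyps by auto
  have sum_u: "(\<Sum>w\<in>?E `` {u}. f w) = f v + (\<Sum>w\<in>E `` {u}. f w)" for f :: "'a \<Rightarrow> real"
    unfolding nbr_u by (rule sum.insert[OF finE vE])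
  note hall = attach.prems(1)[unfolded hall_condition_def, rule_format]
  note dom = attach.prems(3)
  have dom_u: "a u v + (\<Sum>w\<in>E `` {u}. a u w) \<le> d u" if "u \<notin> Y"
    using dom[of u] sum_u[of "a u"] that attach.hyps by auto
  have a_pos: "0 < a w z" if "(w, z) \<in> ?E" "w \<notin> Y" for w z using attach.prems(2) that by blast
  have domV: "(\<Sum>z\<in>E `` {w}. a w z) \<le> d w" if "w \<in> V - Y" for w
  proof (cases "w = u")
    case True
    with dom_u a_pos[of u v] that show ?thesis by auto
  next
    case False
    with dom[of w] nbr[of w] that show ?thesis by auto
  qed
  have row_u: "a v u * x v + (\<Sum>w\<in>E `` {u}. a w u * x w) = d u * x u" if "u \<notin> X"
    using attach.prems(6)[of u] sum_u[of "\<lambda>w. a w u * x w"] that attach.hyps by auto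
  have row_v: "a u v * x u = d v * x v" if "v \<notin> X"
    using attach.prems(6)[of v] nbr_v that by auto
  have row: "(\<Sum>z\<in>E `` {w}. a z w * x z) = d w * x w" if "w \<in> V - X" "w \<noteq> u" for w
    using attach.prems(6)[of w] nbr[of w] that by auto
  have xY: "x w = 0" if "w \<in> insert v V" "w \<in> Y" for w using attach.prems(5) that by auto
  consider (both) "v \<in> X" "v \<in> Y" | (neither) "v \<notin> X" "v \<notin> Y"
    | (Y) "v \<notin> X" "v \<in> Y" | (X) "v \<in> X" "v \<notin> Y" by blast
  thus ?case
  proof cases
    case both
    have xv: "x v = 0" using xY both by auto
    have "\<forall>w\<in>V. x w = 0"
    proof (rule attach.IH[of "X - {v}" "Y - {v}" d])
      show "hall_condition V E (X - {v}) (Y - {v})"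
        unfolding hall_condition_def
      proof (intro allI impI)
        fix R assume R: "R \<subseteq> V - (Y - {v})"
        hence "R \<subseteq> insert v V - Y" using both attach.hyps by auto
        hence "card R \<le> card (R \<union> ?E `` R - X)" by (rule hall)
        also have "R \<union> ?E `` R - X = R \<union> E `` R - (X - {v})"
          using R both attach.hyps vE[of R] by auto
        finally show "card R \<le> card (R \<union> E `` R - (X - {v}))" .
      qed
      \<comment> \<open>Deleting \<open>v\<close> takes the positive \<open>a u v\<close> out of the
        column sum of \<open>u\<close> but keeps \<open>d u\<close>. Unless \<open>u\<close> lies in
        \<open>Y\<close>, its column becomes strict, which replaces the lost vertex \<open>v\<close>
        of \<open>Y\<close>.\<close>
      show "V \<inter> (Y - {v}) \<noteq> {} \<or> (\<exists>w\<in>V. (\<Sum>z\<in>E `` {w}. a w z) < d w)"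
      proof (cases "u \<in> Y")
        case True thus ?thesis using attach.hyps uv by blast
      next
        case False
        hence "(\<Sum>z\<in>E `` {u}. a u z) < d u" using dom_u a_pos[of u v] by auto
        thus ?thesis using attach.hyps by blast
      qed
      show "(\<Sum>v\<in>E `` {w}. a v w * x v) = d w * x w" if "w \<in> V - (X - {v})" for w
        using that row row_u xv attach.hyps by (cases "w = u") auto
      show "0 < a w z" if "(w, z) \<in> E" "w \<notin> Y - {v}" for w z
        using that a_pos[of w z] EV attach.hyps by auto
      show "(\<Sum>z\<in>E `` {w}. a w z) \<le> d w" if "w \<in> V - (Y - {v})" for w
        using that domV attach.hyps by auto
      show "x w = 0" if "w \<in> V \<inter> (Y - {v})" for w using that xY by auto
    qed
    thus ?thesis using xv by auto
  next
    case neither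
    have dv: "a v u \<le> d v" "0 < a v u" using dom[of v] nbr_v a_pos[of v u] neither by auto
    hence dv_pos: "0 < d v" by linarith
    have xv: "x v = a u v * x u / d v" using row_v neither dv_pos by (simp add: field_simps)
    \<comment> \<open>A Schur complement: substituting \<open>x v\<close> into the row of
      \<open>u\<close> changes only the diagonal entry. As \<open>a v u \<le> d v\<close>, the entry
      drops by at most the \<open>a u v\<close> that leaves the column sum of \<open>u\<close>, so
      dominance survives for \<open>u\<close> outside \<open>Y\<close>.\<close>
    define d' where "d' = d(u := d u - a v u * a u v / d v)"
    have loss: "a v u * a u v / d v \<le> a u v" if "u \<notin> Y"
      using dv dv_pos a_pos[of u v] that by (simp add: field_simps)
    have d'u: "d u - a u v \<le> d' u" if "u \<notin> Y" using loss that by (simp add: d'_def)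
    have "\<forall>w\<in>V. x w = 0"
    proof (rule attach.IH[of X Y d'])
      show "hall_condition V E X Y"
        unfolding hall_condition_def
      proof (intro allI impI)
        fix R assume R: "R \<subseteq> V - Y"
        have finR: "finite R" using R fin finite_subset by blast
        show "card R \<le> card (R \<union> E `` R - X)"
        \<comment> \<open>If \<open>u\<close> is in \<open>R\<close>, the row of \<open>v\<close> is
          already among the neighbours, and adding \<open>v\<close> to \<open>R\<close> raises both
          sides by one. Otherwise removing \<open>v\<close> leaves the neighbourhood of
          \<open>R\<close> unchanged.\<close>
        proof (cases "u \<in> R")
          case True
          have "card (insert v R) \<le> card (insert v R \<union> ?E `` insert v R - X)"
            using R neither by (intro hall) auto
          also have "insert v R \<union> ?E `` insert v R - X = insert v (R \<union> E `` R - X)"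
            using True neither attach.hyps EV by auto
          finally show ?thesis
            using finR finE R attach.hyps vE[of R] by (subst (asm) (1 2) card_insert_disjoint) auto
        next
          case False
          have "card R \<le> card (R \<union> ?E `` R - X)" using R by (intro hall) auto
          thus ?thesis using nbrs[of R] R False by fastforce
        qed
      qed
      show "(\<Sum>z\<in>E `` {w}. a w z) \<le> d' w" if "w \<in> V - Y" for w
        using that domV[of w] dom_u d'u by (cases "w = u") (auto simp: d'_def)
      show "V \<inter> Y \<noteq> {} \<or> (\<exists>w\<in>V. (\<Sum>z\<in>E `` {w}. a w z) < d' w)"
      proof (cases "V \<inter> Y = {}")
        case True
        hence uY: "u \<notin> Y" using attach.hyps by blast
        obtain w where w: "w \<in> insert v V" "(\<Sum>z\<in>?E `` {w}. a w z) < d w"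
          using attach.prems(4) True neither by auto
        \<comment> \<open>Strictness at \<open>v\<close> makes the drop at \<open>u\<close> smaller
          than \<open>a u v\<close> and thus passes to \<open>u\<close>; strictness at any other
          vertex stays there.\<close>
        consider "w = v" | "w = u" | "w \<in> V" "w \<noteq> u" using w by auto
        hence "\<exists>w\<in>V. (\<Sum>z\<in>E `` {w}. a w z) < d' w"
        proof cases
          case 1
          hence "a v u < d v" using w nbr_v by simp
          hence "a v u * a u v / d v < a u v" using dv_pos a_pos[of u v] uY by (simp add: field_simps)
          thus ?thesis using dom_u[OF uY] attach.hyps by (intro bexI[of _ u]) (auto simp: d'_def)
        next
          case 2
          hence "a u v + (\<Sum>z\<in>E `` {u}. a u z) < d u" using w sum_u[of "a u"] by simp
          thus ?thesis using d'u[OF uY] attach.hyps by (intro bexI[of _ u]) auto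
        next
          case 3
          thus ?thesis using w nbr[of w] by (intro bexI[of _ w]) (auto simp: d'_def)
        qed
        thus ?thesis ..
      qed auto
      show "(\<Sum>z\<in>E `` {w}. a z w * x z) = d' w * x w" if "w \<in> V - X" for w
      proof (cases "w = u")
        case True
        thus ?thesis using row_u that by (simp add: d'_def xv algebra_simps)
      next
        case False
        thus ?thesis using row that by (simp add: d'_def)
      qed
    qed (use a_pos xY in auto)
    thus ?thesis using xv attach.hyps by auto
  next
    case Y
    have xv: "x v = 0" using xY Y by auto
    \<comment> \<open>With \<open>x v = 0\<close> the row of \<open>v\<close> says
      \<open>a u v * x u = 0\<close>, so \<open>u\<close> can take over the role of \<open>v\<close>
      in \<open>Y\<close>.\<close>
    have xu: "x u = 0"
    proof (cases "u \<in> Y")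
      case True thus ?thesis using xY attach.hyps by auto
    next
      case False
      thus ?thesis using row_v Y xv a_pos[of u v] by auto
    qed
    have "\<forall>w\<in>V. x w = 0"
    proof (rule attach.IH[of X "insert u (Y - {v})" d])
      show "hall_condition V E X (insert u (Y - {v}))"
        unfolding hall_condition_def
      proof (intro allI impI)
        fix R assume R: "R \<subseteq> V - insert u (Y - {v})"
        have "card R \<le> card (R \<union> ?E `` R - X)" using R Y attach.hyps by (intro hall) auto
        thus "card R \<le> card (R \<union> E `` R - X)" using nbrs[of R] R by fastforce
      qed
      show "(\<Sum>v\<in>E `` {w}. a v w * x v) = d w * x w" if "w \<in> V - X" for w
        using that row row_u xv by (cases "w = u") auto
      show "0 < a w z" if "(w, z) \<in> E" "w \<notin> insert u (Y - {v})" for w z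
        using that a_pos[of w z] EV attach.hyps by auto
      show "(\<Sum>z\<in>E `` {w}. a w z) \<le> d w" if "w \<in> V - insert u (Y - {v})" for w
        using that domV attach.hyps by auto
    qed (use xY xu attach.hyps in auto)
    thus ?thesis using xv by auto
  next
    case X
    \<comment> \<open>The leaf has an unknown but no row of its own; only the row of
      \<open>u\<close> can serve it, so \<open>u\<close> lies outside \<open>X\<close>. Moving
      \<open>u\<close> into \<open>X\<close> reserves that row for determining \<open>x v\<close> at
      the end.\<close>
    have "card {v} \<le> card ({v} \<union> ?E `` {v} - X)" using X by (intro hall) auto
    hence uX: "u \<notin> X" using X nbr_v by (cases "u \<in> X") auto
    \<comment> \<open>The strict column might be that of \<open>v\<close>, so a vertex of
      \<open>Y\<close> is produced instead: without one, Hall's condition would ask for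
      \<open>card V + 1\<close> rows, while the row of \<open>v\<close> is missing.\<close>
    have Y_ne: "V \<inter> Y \<noteq> {}"
    proof
      assume "V \<inter> Y = {}"
      hence "card (insert v V) \<le> card (insert v V \<union> ?E `` insert v V - X)"
        using X by (intro hall) auto
      also have "\<dots> \<le> card V" using EV attach.hyps X fin by (intro card_mono) auto
      finally show False using fin attach.hyps by simp
    qed
    have "\<forall>w\<in>V. x w = 0"
    proof (rule attach.IH[of "insert u (X - {v})" Y d])
      show "hall_condition V E (insert u (X - {v})) Y"
        unfolding hall_condition_def
      proof (intro allI impI)
        fix R assume R: "R \<subseteq> V - Y"
        have finR: "finite R" using R fin finite_subset by blast
        have "card (insert v R) \<le> card (insert v R \<union> ?E `` insert v R - X)"
          using R X by (intro hall) auto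
        also have "insert v R \<union> ?E `` insert v R - X
            = insert u (R \<union> E `` R - insert u (X - {v}))"
          using X uX R EV attach.hyps by auto
        finally show "card R \<le> card (R \<union> E `` R - insert u (X - {v}))"
          using finR finE R attach.hyps vE[of R] by (subst (asm) (1 2) card_insert_disjoint) auto
      qed
      show "(\<Sum>v\<in>E `` {w}. a v w * x v) = d w * x w" if "w \<in> V - insert u (X - {v})" for w
        using that row attach.hyps by (cases "w = u") auto
    qed (use a_pos xY Y_ne domV attach.hyps in auto)
    moreover from this have "(\<Sum>w\<in>E `` {u}. a w u * x w) = 0"
      using EV by (intro sum.neutral) auto
    ultimately have "a v u * x v = 0" using row_u[OF uX] attach.hyps by simp
    thus ?thesis using a_pos[of v u] X \<open>\<forall>w\<in>V. x w = 0\<close> by auto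
  qed
qed


section \<open>Trees and vertex cuts\<close>

text \<open>A path to or from the newest leaf passes through its neighbour. Confinement to
  \<open>W\<close> matters when such a path is closed to a cycle through a vertex outside
  \<open>W\<close>.\<close>

lemma (in pair_wf_digraph) leaf_tree_apath:
  assumes "leaf_tree W F" and "W \<subseteq> pverts G" and "F \<subseteq> parcs G" and "x \<in> W" and "y \<in> W"
  shows "\<exists>p. apath x p y \<and> set (pawalk_verts x p) \<subseteq> W"
  using assms
proof (induction arbitrary: x y rule: leaf_tree.induct)
  case (single v)
  thus ?case by (intro exI[of _ "[]"]) (auto simp: apath_Nil_iff)
next
  case (attach W F u v)
  have sub: "W \<subseteq> pverts G" "F \<subseteq> parcs G" and arcs: "(u, v) \<in> parcs G" "(v, u) \<in> parcs G"
    and vG: "v \<in> pverts G"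
    using attach.prems by auto
  note IH = attach.IH[OF sub]
  consider "x = v" "y = v" | "x = v" "y \<in> W" | "x \<in> W" "y = v" | "x \<in> W" "y \<in> W"
    using attach.prems by auto
  thus ?case
  proof cases
    case 1
    thus ?thesis using vG by (intro exI[of _ "[]"]) (auto simp: apath_Nil_iff)
  next
    case 2
    obtain p where p: "apath u p y" "set (pawalk_verts u p) \<subseteq> W"
      using IH 2 attach.hyps by blast
    thus ?thesis using 2 arcs attach.hyps
      by (intro exI[of _ "(v, u) # p"]) (auto simp: apath_Cons_iff)
  next
    case 3
    obtain p where p: "apath x p u" "set (pawalk_verts x p) \<subseteq> W"
      using IH 3 attach.hyps by blast
    have "awalk x p u" "last (pawalk_verts x p) = u"
      using p(1) by (auto simp: apath_def)
    hence walk: "awalk x (p @ [(u, v)]) v"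
      using arcs vG by (simp add: awalk_simps)
    hence "pawalk_verts x (p @ [(u, v)]) = pawalk_verts x p @ [v]"
      using awalk_verts_append[OF walk] by simp
    thus ?thesis using walk p 3 attach.hyps
      by (intro exI[of _ "p @ [(u, v)]"]) (auto simp: apath_def)
  next
    case 4
    thus ?thesis using IH by blast
  qed
qed

text \<open>
  A maximal leaf-built subtree is everything: a further vertex adjacent to two of its vertices
  would close a cycle with at least three arcs.
\<close>

lemma two_way_tree_leaf_tree:
  assumes "pair_graph H" and "two_way_tree H"
  shows "leaf_tree (pverts H) (parcs H)"
proof -
  interpret pair_graph H by fact
  let ?P = "\<lambda>W. W \<subseteq> pverts H \<and> leaf_tree W (parcs H \<inter> W \<times> W)"
  \<comment> \<open>Connectedness is strong connectedness of the symmetric closure, which has the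
    same arcs here because \<open>H\<close> is symmetric.\<close>
  have symm: "parcs (mk_symmetric (with_proj H)) = parcs H"
    using adj_mk_symmetric_eq[OF sym_arcs] by simp
  have conn: "strongly_connected (with_proj (mk_symmetric (with_proj H)))"
    using assms(2) by (simp add: two_way_tree_def connected_def)
  hence reach: "(x, y) \<in> (parcs H)\<^sup>*" if "x \<in> pverts H" "y \<in> pverts H" for x y
  proof -
    have "x \<rightarrow>\<^sup>*\<^bsub>with_proj (mk_symmetric (with_proj H))\<^esub> y"
      using conn that by (auto simp: strongly_connected_def)
    from reachable_rtranclI[OF this] show ?thesis by (simp add: symm)
  qed
  obtain r where r: "r \<in> pverts H" using conn by (auto simp: strongly_connected_def)
  have "parcs H \<inter> {r} \<times> {r} = {}" using no_loops' by auto
  hence "?P {r}" using leaf_tree.single[of r] r by simp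
  moreover have "\<forall>W. ?P W \<longrightarrow> card W < Suc (card (pverts H))"
    using card_mono[OF pair_finite_verts] by (simp add: less_Suc_eq_le)
  ultimately obtain W where W: "?P W" and maximal: "\<And>W'. ?P W' \<Longrightarrow> card W' \<le> card W"
    using ex_has_greatest_nat[of ?P "{r}" card "Suc (card (pverts H))"] by blast
  have finW: "finite W" using W pair_finite_verts finite_subset by blast
  have "W \<noteq> {}" using W by (auto elim: leaf_tree.cases)
  then obtain w0 where w0: "w0 \<in> W" by blast
  have "W = pverts H"
  proof (rule ccontr)
    assume "W \<noteq> pverts H"
    then obtain y where y: "y \<in> pverts H" "y \<notin> W" using W by blast
    have "(w0, y) \<in> (parcs H)\<^sup>*" using reach w0 W y by blast
    hence "y \<notin> W \<longrightarrow> (\<exists>w v. (w, v) \<in> parcs H \<and> w \<in> W \<and> v \<notin> W)"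
      by (induction rule: rtrancl_induct) (use w0 in auto)
    then obtain w v where wv: "(w, v) \<in> parcs H" "w \<in> W" "v \<notin> W" using y by blast
    have unique: "z = w" if z: "(z, v) \<in> parcs H" "z \<in> W" for z
    proof (rule ccontr)
      assume ne: "z \<noteq> w"
      obtain p where p: "apath w p z" "set (pawalk_verts w p) \<subseteq> W"
        using leaf_tree_apath[of W "parcs H \<inter> W \<times> W" w z] W wv z by blast
      hence "p \<noteq> []" using ne by (auto simp: apath_Nil_iff)
      \<comment> \<open>From \<open>v\<close> to \<open>w\<close>, inside \<open>W\<close> to
        \<open>z\<close>, and back to \<open>v\<close>. As \<open>z\<close> differs from
        \<open>w\<close>, \<open>p\<close> is nonempty, so this is not just an arc and its
        reverse.\<close>
      let ?c = "(v, w) # p @ [(z, v)]"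
      have "awalk w p z" "last (pawalk_verts w p) = z"
        using p(1) by (auto simp: apath_def)
      hence walk: "awalk w (p @ [(z, v)]) v"
        using z wv in_arcsD2 by (simp add: awalk_simps)
      hence verts: "pawalk_verts w (p @ [(z, v)]) = pawalk_verts w p @ [v]"
        using awalk_verts_append[OF walk] by simp
      have "awalk v ?c v" using walk arcs_symmetric[OF wv(1)] by (auto simp: awalk_Cons_iff)
      moreover have "distinct (tl (pawalk_verts v ?c))"
        using p wv(3) by (auto simp: verts apath_def)
      ultimately have "cycle ?c" unfolding cycle_def by blast
      moreover have "3 \<le> length ?c" using \<open>p \<noteq> []\<close> by (cases p) auto
      ultimately show False using assms(2) unfolding two_way_tree_def by blast
    qed
    have "parcs H \<inter> insert v W \<times> insert v W = {(w, v), (v, w)} \<union> parcs H \<inter> W \<times> W"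
    proof (rule equalityI; rule subrelI)
      fix y z assume "(y, z) \<in> parcs H \<inter> insert v W \<times> insert v W"
      hence yz: "(y, z) \<in> parcs H" "(z, y) \<in> parcs H" "y \<in> insert v W" "z \<in> insert v W" "y \<noteq> z"
        using arcs_symmetric no_loops' by auto
      thus "(y, z) \<in> {(w, v), (v, w)} \<union> parcs H \<inter> W \<times> W"
        using unique[of y] unique[of z] by auto
    next
      fix y z assume "(y, z) \<in> {(w, v), (v, w)} \<union> parcs H \<inter> W \<times> W"
      thus "(y, z) \<in> parcs H \<inter> insert v W \<times> insert v W"
        using wv arcs_symmetric[OF wv(1)] by auto
    qed
    hence "?P (insert v W)" using leaf_tree.attach[of W _ w v] W wv in_arcsD2 by auto
    from maximal[OF this] show False using finW wv(3) by simp
  qed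
  moreover have "parcs H \<inter> pverts H \<times> pverts H = parcs H" using wellformed' by auto
  ultimately show ?thesis using W by simp
qed

text \<open>
  A set \<open>R\<close> avoiding \<open>Y\<close> yields the cut \<open>(X \<union> E `` R) - R\<close>; conversely, a cut \<open>S\<close> yields the set
  \<open>R\<close> of vertices reachable from \<open>X\<close> without meeting \<open>S\<close>.
\<close>

lemma hall_condition_iff_vertex_cut:
  assumes "pair_fin_digraph H" and "X \<subseteq> pverts H"
  shows "hall_condition (pverts H) (parcs H) X Y \<longleftrightarrow> (\<forall>S. vertex_cut H X Y S \<longrightarrow> card X \<le> card S)"
proof -
  interpret pair_fin_digraph H by fact
  let ?V = "pverts H" and ?E = "parcs H"
  note fin = finite_subset[OF _ pair_finite_verts]
  have E_V: "?E `` R \<subseteq> ?V" for R using wellformed' by auto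
  show ?thesis
  proof (intro iffI allI impI)
    fix S
    assume hall: "hall_condition ?V ?E X Y" and cut: "vertex_cut H X Y S"
    define R where "R = {last p | p. vwalk p (with_proj H) \<and> hd p \<in> X \<and> set p \<inter> S = {}}"
    have S: "S \<subseteq> ?V" using cut by (simp add: vertex_cut_def)
    \<comment> \<open>\<open>R\<close> is built from walks because these extend freely; the cut
      speaks of paths, and shortening a walk to a path adds no vertices.\<close>
    have "last p \<notin> Y" if p: "vwalk p (with_proj H)" "hd p \<in> X" "set p \<inter> S = {}" for p
      using cut vwalk_to_vpath_vpath[OF p(1)] p vwalk_to_vpath_subset[of _ p]
      unfolding vertex_cut_def
      by (metis (no_types, lifting) disjoint_iff vwalk_to_vpath_hd vwalk_to_vpath_last)
    hence RY: "R \<subseteq> ?V - Y" by (auto simp: R_def vwalk_def)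
    have XRS: "X \<subseteq> R \<union> S"
    proof
      fix x assume "x \<in> X"
      thus "x \<in> R \<union> S"
        using assms(2) unfolding R_def
        by (cases "x \<in> S") (auto intro!: exI[of _ "[x]"] simp: vwalk_def)
    qed
    have ERS: "?E `` R \<subseteq> R \<union> S"
    proof clarify
      fix r v assume rv: "r \<in> R" "(r, v) \<in> ?E" "v \<notin> S"
      then obtain p where p: "vwalk p (with_proj H)" "hd p \<in> X" "set p \<inter> S = {}" "r = last p"
        by (auto simp: R_def)
      hence "vwalk (p @ [v]) (with_proj H)"
        using rv wellformed' by (auto simp: vwalk_def set_vwalk_arcs_snoc)
      moreover have "hd (p @ [v]) \<in> X" using p by (auto simp: vwalk_def)
      ultimately show "v \<in> R" using p rv unfolding R_def
        by (intro CollectI exI[of _ "p @ [v]"]) auto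
    qed
    have finRS: "finite R" "finite S" "finite X" using RY S assms(2) by (auto intro!: fin)
    \<comment> \<open>\<open>R \<union> S\<close> contains both the neighbours of \<open>R\<close>
      and all of \<open>X\<close>; the latter also justifies undoing the truncated subtraction
      below.\<close>
    have "card R \<le> card (R \<union> ?E `` R - X)" using hall RY by (simp add: hall_condition_def)
    also have "\<dots> \<le> card (R \<union> S - X)" using ERS finRS by (intro card_mono) auto
    also have "\<dots> = card (R \<union> S) - card X" using XRS finRS by (intro card_Diff_subset) auto
    finally have "card R + card X \<le> card (R \<union> S)"
      using card_mono[OF _ XRS] finRS by simp
    also have "\<dots> \<le> card R + card S" by (rule card_Un_le)
    finally show "card X \<le> card S" by simp
  next
    assume cuts: "\<forall>S. vertex_cut H X Y S \<longrightarrow> card X \<le> card S"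
    show "hall_condition ?V ?E X Y" unfolding hall_condition_def
    proof (intro allI impI)
      fix R assume R: "R \<subseteq> ?V - Y"
      define S where "S = (X \<union> ?E `` R) - R"
      \<comment> \<open>Every arc leaving \<open>R\<close> ends in \<open>S\<close>, so a walk that
        starts in \<open>R\<close> and avoids \<open>S\<close> never leaves
        \<open>R\<close>.\<close>
      have stay: "last p \<in> R"
        if "vwalk p (with_proj H)" "hd p \<in> R" "set p \<inter> S = {}" for p
        using that
      proof (induction p rule: vwalk_induct)
        case (Cons u v es)
        thus ?case by (auto simp: S_def)
      qed auto
      have "vertex_cut H X Y S" unfolding vertex_cut_def
      proof (intro conjI allI impI notI)
        show "S \<subseteq> ?V" using assms(2) E_V by (auto simp: S_def)
        fix p assume p: "vpath p (with_proj H) \<and> hd p \<in> X \<and> last p \<in> Y" and "set p \<inter> S = {}"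
        moreover have "hd p \<in> set p" using p by (auto simp: vpath_def vwalk_def)
        ultimately have "hd p \<in> R" by (auto simp: S_def)
        thus False using stay[of p] p \<open>set p \<inter> S = {}\<close> R by (auto simp: vpath_def)
      qed
      hence le: "card X \<le> card S" using cuts by blast
      have finR: "finite R" "finite X" "finite (?E `` R)"
        using R assms(2) E_V[of R] by (auto intro: fin)
      have "card X + card R \<le> card S + card R" using le by simp
      also have "\<dots> = card (S \<union> R)" using finR by (subst card_Un_disjoint) (auto simp: S_def)
      also have "S \<union> R = X \<union> (R \<union> ?E `` R - X)" by (auto simp: S_def)
      also have "card \<dots> = card X + card (R \<union> ?E `` R - X)"
        using finR by (subst card_Un_disjoint) auto
      finally show "card R \<le> card (R \<union> ?E `` R - X)" by simp
    qed
  qed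
qed


section \<open>The flow block of an unmonitored component\<close>

locale unmonitored_component =
  fixes G H :: "'a pair_pre_digraph" and B M :: "'a set"
    and c :: "'a \<times> 'a \<Rightarrow> real" and e :: "'a \<Rightarrow> 'a \<times> 'a"
  assumes pair_graph_G: "pair_graph G"
    and turning_ratio_pos: "\<And>a. a \<in> parcs G \<Longrightarrow> 0 < c a"
    and canonical_arc: "\<And>v. v \<in> pverts G \<Longrightarrow> out_arcs (with_proj G) v \<noteq> {} \<Longrightarrow> e v \<in> out_arcs (with_proj G) v"
    and component: "connected_component (unmonitored_subgraph G M) H"
begin

abbreviation "V \<equiv> pverts H"
abbreviation "E \<equiv> parcs H"
abbreviation "X \<equiv> (B - M) \<inter> V"
abbreviation "Y \<equiv> adjacent_to G M \<inter> V"
abbreviation "a \<equiv> turning_factor c e"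

text \<open>The negated diagonal entry of a canonical column. Outside \<open>Y\<close> all
  neighbours in \<open>G\<close> are neighbours in \<open>H\<close>, so these columns sum to zero
  and are dominant with equality.\<close>

definition d :: "'a \<Rightarrow> real" where "d v = (\<Sum>u\<in>E `` {v}. a v u)"

sublocale G: pair_graph G by (rule pair_graph_G)

section \<open>The component as a symmetric graph closed under adjacency\<close>

lemma parcs_unmonitored:
  "parcs (unmonitored_subgraph G M) = {(u, v) \<in> parcs G.
     \<not> (u \<in> M \<union> adjacent_to G M \<and> v \<in> M \<union> adjacent_to G M)}"
  by (auto simp: unmonitored_subgraph_def combined_cutset_def)

lemma subgraph_H: "subgraph (with_proj H) (with_proj (unmonitored_subgraph G M))"
  and connected_H: "connected (with_proj H)"
  using component by (auto simp: connected_component_def pre_digraph.max_subgraph_def)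

lemma V_subset: "V \<subseteq> pverts G - M"
  using subgraph_H by (auto simp: subgraph_def unmonitored_subgraph_def)

lemma E_subset: "E \<subseteq> parcs (unmonitored_subgraph G M)"
  using subgraph_H by (auto simp: subgraph_def)

sublocale H: pair_wf_digraph H
  using subgraph_H by (auto simp: subgraph_def wf_digraph_wp_iff)

text \<open>By maximality: adjoining \<open>v\<close> and both arcs keeps the component connected,
  since \<open>u\<close> links every vertex, so nothing new was adjoined.\<close>

lemma component_arc:
  assumes "u \<in> V"
    and arc: "(u, v) \<in> parcs (unmonitored_subgraph G M) \<or> (v, u) \<in> parcs (unmonitored_subgraph G M)"
  shows "(u, v) \<in> E" and "(v, u) \<in> E"
proof -
  let ?N = "unmonitored_subgraph G M"
  define H' where "H' = \<lparr>pverts = insert v V, parcs = {(u, v), (v, u)} \<union> E\<rparr>"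
  have arcs: "(u, v) \<in> parcs ?N" "(v, u) \<in> parcs ?N"
    using arc G.arcs_symmetric by (auto simp: parcs_unmonitored)
  have wf_N: "wf_digraph (with_proj ?N)" using subgraph_H by (simp add: subgraph_def)
  hence vG: "v \<in> pverts ?N" using arcs wf_digraph_wp_iff pair_wf_digraph.in_arcsD1 by metis
  have wf': "wf_digraph (with_proj H')"
    unfolding wf_digraph_wp_iff
    by unfold_locales (use assms(1) H.in_arcsD1 H.in_arcsD2 in \<open>auto simp: H'_def\<close>)
  have sub_N: "subgraph (with_proj H') (with_proj ?N)"
    using subgraph_H arcs vG wf' wf_N by (auto simp: subgraph_def H'_def)
  have sub_H: "subgraph (with_proj H) (with_proj H')"
    using wf' H.wf_digraph_axioms by (auto simp: subgraph_def H'_def)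
  let ?S = "with_proj (mk_symmetric (with_proj H))"
  let ?S' = "with_proj (mk_symmetric (with_proj H'))"
  have arcs_S': "arcs_ends ?S \<subseteq> arcs_ends ?S'" "(u, v) \<in> arcs_ends ?S'" "(v, u) \<in> arcs_ends ?S'"
    by (auto simp: parcs_mk_symmetric H'_def)
  have S_wf: "wf_digraph ?S'"
    using wf_digraph.wellformed_mk_symmetric[OF wf'] by (simp add: wf_digraph_wp_iff)
  have old: "x \<rightarrow>\<^sup>*\<^bsub>?S'\<^esub> y" if "x \<in> V" "y \<in> V" for x y
  proof -
    have "x \<rightarrow>\<^sup>*\<^bsub>?S\<^esub> y" using connected_H that by (auto simp: connected_def strongly_connected_def)
    thus ?thesis unfolding reachable_def
      by (rule rtrancl_on_mono[rotated 2]) (use arcs_S' in \<open>auto simp: H'_def\<close>)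
  qed
  have uv: "u \<rightarrow>\<^sup>*\<^bsub>?S'\<^esub> v" "v \<rightarrow>\<^sup>*\<^bsub>?S'\<^esub> u"
    using arcs_S' wf_digraph.reachable_adjI[OF S_wf] by auto
  have to_u: "x \<rightarrow>\<^sup>*\<^bsub>?S'\<^esub> u" "u \<rightarrow>\<^sup>*\<^bsub>?S'\<^esub> x" if "x \<in> insert v V" for x
    using that uv old assms(1) by auto
  have "connected (with_proj H')"
    unfolding connected_def
  proof (rule strongly_connectedI)
    show "verts ?S' \<noteq> {}" by (simp add: H'_def)
    fix x y assume "x \<in> verts ?S'" "y \<in> verts ?S'"
    thus "x \<rightarrow>\<^sup>*\<^bsub>?S'\<^esub> y"
      using wf_digraph.reachable_trans[OF S_wf to_u(1)[of x] to_u(2)[of y]] by (simp add: H'_def)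
  qed
  hence "with_proj H' = with_proj H"
    using component sub_N sub_H unfolding connected_component_def pre_digraph.max_subgraph_def by blast
  hence "parcs H' = E" by (metis with_proj_simps(2))
  thus "(u, v) \<in> E" "(v, u) \<in> E" by (auto simp: H'_def)
qed

sublocale H: pair_graph H
proof unfold_locales
  show "finite V" using V_subset G.pair_finite_verts by (meson finite_Diff finite_subset)
  show "finite E"
    using E_subset parcs_unmonitored G.pair_finite_arcs by (auto intro: finite_subset)
  show "fst x \<noteq> snd x" if "x \<in> E" for x
    using that E_subset parcs_unmonitored G.pair_no_loops by auto
  show "symmetric (with_proj H)"
    unfolding symmetric_def
    by (rule symI) (use component_arc(2) E_subset H.in_arcsD1 in auto)
qed

text \<open>An arc of the combined cutset has both ends in \<open>M\<close> or \<open>A(M)\<close>.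
  A vertex outside both therefore keeps all its arcs, and they stay in its component.\<close>

lemma arc_iff:
  assumes "v \<in> V - Y"
  shows "(v, u) \<in> parcs G \<longleftrightarrow> (v, u) \<in> E"
proof
  assume arc: "(v, u) \<in> parcs G"
  have "v \<notin> M \<union> adjacent_to G M" using assms V_subset by auto
  hence "(v, u) \<in> parcs (unmonitored_subgraph G M)" using arc by (auto simp: parcs_unmonitored)
  thus "(v, u) \<in> E" using component_arc(1) assms by blast
qed (use E_subset parcs_unmonitored in auto)

section \<open>Entries and rows of the block\<close>

lemma turning_factor_pos:
  assumes "(v, u) \<in> parcs G"
  shows "0 < a v u"
proof -
  have "e v \<in> out_arcs (with_proj G) v"
    using assms G.in_arcsD1 by (intro canonical_arc) (auto simp: out_arcs_def)
  thus ?thesis using assms turning_ratio_pos by (simp add: turning_factor_def)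
qed

lemma flow_entry_canonical:
  assumes "v \<in> V - Y"
  shows "flow_entry G c e u (Canonical v) =
    (if (v, u) \<in> E then a v u else 0) - (if u = v then d v else 0)"
proof -
  have "{w. (v, w) \<in> parcs G} = E `` {v}" using arc_iff[OF assms] by auto
  moreover have "(v, v) \<notin> E" using H.no_loops' by blast
  ultimately show ?thesis using arc_iff[OF assms] by (auto simp: d_def)
qed

lemma block_columns:
  "{k. k \<in> flow_columns G B M \<and> col_vertex k \<in> V} = Canonical ` (V - Y) \<union> Balancing ` X"
  using V_subset by (auto simp: flow_columns_def)

lemma flow_entry_sum:
  assumes "u \<in> V" and "R \<subseteq> V - Y"
  shows "(\<Sum>k\<in>Canonical ` R \<union> Balancing ` X. flow_entry G c e u k * z k) =
    (\<Sum>v\<in>E `` {u} \<inter> R. a v u * z (Canonical v))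
      - (if u \<in> R then d u * z (Canonical u) else 0) + (if u \<in> X then z (Balancing u) else 0)"
proof -
  have fin: "finite R" "finite X" using assms(2) finite_subset[OF _ H.pair_finite_verts] by auto
  have "(\<Sum>k\<in>Canonical ` R \<union> Balancing ` X. flow_entry G c e u k * z k)
      = (\<Sum>v\<in>R. flow_entry G c e u (Canonical v) * z (Canonical v))
        + (\<Sum>b\<in>X. flow_entry G c e u (Balancing b) * z (Balancing b))"
    using fin by (subst sum.union_disjoint) (auto simp: sum.reindex inj_on_def)
  also have "(\<Sum>b\<in>X. flow_entry G c e u (Balancing b) * z (Balancing b))
      = (\<Sum>b\<in>X. if u = b then z (Balancing b) else 0)"
    by (intro sum.cong) auto
  also have "\<dots> = (if u \<in> X then z (Balancing u) else 0)" using fin by (simp add: sum.delta')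
  also have "(\<Sum>v\<in>R. flow_entry G c e u (Canonical v) * z (Canonical v))
      = (\<Sum>v\<in>R. (if v \<in> E `` {u} then a v u * z (Canonical v) else 0)
          - (if u = v then d v * z (Canonical v) else 0))"
  proof (intro sum.cong refl)
    fix v assume "v \<in> R"
    hence v: "v \<in> V - Y" using assms(2) by blast
    have "(v, u) \<in> E \<longleftrightarrow> v \<in> E `` {u}" using H.arcs_symmetric by blast
    thus "flow_entry G c e u (Canonical v) * z (Canonical v)
        = (if v \<in> E `` {u} then a v u * z (Canonical v) else 0)
          - (if u = v then d v * z (Canonical v) else 0)"
      unfolding flow_entry_canonical[OF v] by (simp add: left_diff_distrib)
  qed
  also have "\<dots> = (\<Sum>v\<in>E `` {u} \<inter> R. a v u * z (Canonical v))
      - (if u \<in> R then d u * z (Canonical u) else 0)"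
    unfolding sum_subtractf Int_commute[of "E `` {u}"] sum.inter_restrict[OF fin(1)]
    using fin by (simp add: sum.delta')
  finally show ?thesis .
qed

section \<open>Trivial kernel and Hall's condition\<close>

definition trivial_kernel :: bool where
  "trivial_kernel \<longleftrightarrow> (\<forall>z.
     (\<forall>u\<in>V. (\<Sum>k\<in>Canonical ` (V - Y) \<union> Balancing ` X. flow_entry G c e u k * z k) = 0) \<longrightarrow>
     (\<forall>k\<in>Canonical ` (V - Y) \<union> Balancing ` X. z k = 0))"

lemma full_rank_iff_trivial_kernel:
  assumes "set rs = pverts G - M" and "distinct cs" and "set cs = flow_columns G B M"
  shows "mat_rank (flow_block G c e rs cs H) = dim_col (flow_block G c e rs cs H) \<longleftrightarrow> trivial_kernel"
proof -
  have "\<And>r. r \<in> set rs \<and> r \<in> V \<longleftrightarrow> r \<in> V" using assms(1) V_subset by auto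
  thus ?thesis
    unfolding flow_block_def flow_matrix_def trivial_kernel_def block_columns[symmetric]
      submatrix_rank_eq_dim_col_iff[OF assms(2), where P = "\<lambda>u. u \<in> V" and Q = "\<lambda>k. col_vertex k \<in> V"]
      assms(3)
    by auto
qed

text \<open>The canonical columns of a violating \<open>R\<close>, joined by all balancing columns,
  outnumber the rows that they meet, because the balancing columns add as many columns as rows. The
  resulting nonzero solution extends by zero.\<close>

lemma hall_condition_if_trivial_kernel:
  assumes trivial_kernel
  shows "hall_condition V E X Y"
  unfolding hall_condition_def
proof (intro allI impI, rule ccontr)
  \<comment> \<open>The canonical columns of \<open>R\<close> and all balancing columns vanish outside \<open>?rows\<close>.\<close>
  fix R assume R: "R \<subseteq> V - Y" and "\<not> card R \<le> card (R \<union> E `` R - X)"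
  hence less: "card (R \<union> E `` R - X) < card R" by simp
  let ?rows = "X \<union> (R \<union> E `` R - X)" and ?cols = "Canonical ` R \<union> Balancing ` X"
  let ?all = "Canonical ` (V - Y) \<union> Balancing ` X"
  have "E `` R \<subseteq> V" using H.in_arcsD2 by auto
  hence fin: "finite R" "finite X" "finite (E `` R)"
    using R by (auto intro: finite_subset[OF _ H.pair_finite_verts])
  have "card ?rows = card X + card (R \<union> E `` R - X)"
    using fin by (subst card_Un_disjoint) auto
  moreover have "card ?cols = card R + card X"
    using fin by (subst card_Un_disjoint) (auto simp: card_image inj_on_def)
  ultimately have "card ?rows < card ?cols" using less by simp
  then obtain z where z: "\<exists>k\<in>?cols. z k \<noteq> 0" "\<forall>k. k \<notin> ?cols \<longrightarrow> z k = 0"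
      "\<forall>u\<in>?rows. (\<Sum>k\<in>?cols. flow_entry G c e u k * z k) = 0"
    using homogeneous_system_nontrivial_solution[of ?rows ?cols "flow_entry G c e"] fin by auto
  have "(\<Sum>k\<in>?all. flow_entry G c e u k * z k) = 0" if u: "u \<in> V" for u
  proof -
    have "(\<Sum>k\<in>?all. flow_entry G c e u k * z k) = (\<Sum>k\<in>?cols. flow_entry G c e u k * z k)"
      using R z(2) H.pair_finite_verts by (intro sum.mono_neutral_right) auto
    also have "\<dots> = 0"
    proof (cases "u \<in> ?rows")
      case False
      hence "E `` {u} \<inter> R = {}" using H.arcs_symmetric by blast
      thus ?thesis using False by (subst flow_entry_sum[OF u R]) auto
    qed (use z(3) in blast)
    finally show ?thesis .
  qed
  hence "\<forall>k\<in>?all. z k = 0" using assms unfolding trivial_kernel_def by blast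
  thus False using z(1) R by blast
qed

text \<open>\<open>nonempty\<close> excludes the case in which \<open>X\<close> and \<open>Y\<close>
  are both empty: there Hall's condition holds, yet the block is square with zero column sums and
  hence singular.\<close>

lemma trivial_kernel_if_hall_condition:
  assumes tree: "two_way_tree H" and hall: "hall_condition V E X Y" and nonempty: "X \<noteq> {} \<or> Y \<noteq> {}"
  shows trivial_kernel
  unfolding trivial_kernel_def
proof (intro allI impI)
  fix z
  let ?all = "Canonical ` (V - Y) \<union> Balancing ` X"
  assume z: "\<forall>u\<in>V. (\<Sum>k\<in>?all. flow_entry G c e u k * z k) = 0"
  \<comment> \<open>If \<open>Y\<close> were empty, Hall's condition for all of \<open>V\<close>
    would force \<open>X\<close> to be empty, against \<open>nonempty\<close>. A vertex of
    \<open>Y\<close> is required because every column sum equals \<open>d v\<close>, so no column is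
    strict.\<close>
  have Y_ne: "Y \<noteq> {}"
  proof
    assume "Y = {}"
    hence "card V \<le> card (V \<union> E `` V - X)" using hall by (simp add: hall_condition_def)
    also have "V \<union> E `` V - X = V - X" using H.in_arcsD2 by auto
    finally have "V - X = V"
      using card_subset_eq[OF H.pair_finite_verts, of "V - X"] card_mono[OF H.pair_finite_verts, of "V - X"]
      by force
    thus False using nonempty \<open>Y = {}\<close> by blast
  qed
  \<comment> \<open>Vertices of \<open>Y\<close> have no canonical unknown, hence the value zero
    there.\<close>
  define x where "x v = (if v \<in> V - Y then z (Canonical v) else 0)" for v
  have row: "(\<Sum>v\<in>E `` {u}. a v u * x v) - d u * x u + (if u \<in> X then z (Balancing u) else 0) = 0"
    if u: "u \<in> V" for u
  proof -
    have "E `` {u} \<subseteq> V" using H.in_arcsD2 by auto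
    hence "(\<Sum>v\<in>E `` {u} \<inter> (V - Y). a v u * z (Canonical v)) = (\<Sum>v\<in>E `` {u}. a v u * x v)"
      by (intro sum.mono_neutral_cong_left)
        (auto simp: x_def intro: finite_subset[OF _ H.pair_finite_verts])
    moreover have "(if u \<in> V - Y then d u * z (Canonical u) else 0) = d u * x u"
      by (cases "u \<in> V - Y") (simp_all only: x_def if_True if_False mult_zero_right)
    ultimately show ?thesis using bspec[OF z u] unfolding flow_entry_sum[OF u subset_refl] by simp
  qed
  have "\<forall>v\<in>V. x v = 0"
  proof (rule leaf_tree_kernel_trivial[OF two_way_tree_leaf_tree[OF H.pair_graph tree] hall, of a d])
    show "0 < a v u" if "(v, u) \<in> E" for v u
      using that E_subset by (intro turning_factor_pos) (auto simp: parcs_unmonitored)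
    show "(\<Sum>v\<in>E `` {u}. a v u * x v) = d u * x u" if "u \<in> V - X" for u
      using row[of u] that by auto
  qed (use Y_ne in \<open>auto simp: d_def x_def\<close>)
  moreover from this have "z (Canonical v) = 0" if "v \<in> V - Y" for v
    using that by (metis DiffD1 x_def)
  \<comment> \<open>Once \<open>x\<close> vanishes, the row of a centroid contains only its
    balancing flow.\<close>
  moreover from calculation have "z (Balancing b) = 0" if "b \<in> X" for b
  proof -
    have "(\<Sum>v\<in>E `` {b}. a v b * x v) = 0"
      using calculation H.in_arcsD2 by (intro sum.neutral) auto
    thus ?thesis using row[of b] that calculation by auto
  qed
  ultimately show "\<forall>k\<in>?all. z k = 0" by blast
qed

end

theorem theorem6p1:
  fixes G :: "'a pair_pre_digraph"
    and B M :: "'a set"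
    and c :: "'a \<times> 'a \<Rightarrow> real"
    and e :: "'a \<Rightarrow> 'a \<times> 'a"
    and rs :: "'a list"
    and cs :: "'a flow_column list"
    and H :: "'a pair_pre_digraph"
    and C :: "'a set"
  assumes "pair_graph G"
    and "B \<subseteq> pverts G"
    and "M \<subseteq> pverts G"
    and "\<And>a. a \<in> parcs G \<Longrightarrow> 0 < c a"
    and "\<And>v. v \<in> pverts G \<Longrightarrow> out_arcs (with_proj G) v \<noteq> {} \<Longrightarrow> e v \<in> out_arcs (with_proj G) v"
    and "distinct rs" and "set rs = pverts G - M"
    and "distinct cs" and "set cs = flow_columns G B M"
    and "connected_component (unmonitored_subgraph G M) H"
    and "minimum_vertex_cut H ((B - M) \<inter> pverts H) (adjacent_to G M \<inter> pverts H) C"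
    and "(B - M) \<inter> pverts H \<noteq> {} \<or> adjacent_to G M \<inter> pverts H \<noteq> {}"
    and "two_way_tree H"
  shows "mat_rank (flow_block G c e rs cs H) = dim_col (flow_block G c e rs cs H)
     \<longleftrightarrow> card C = card ((B - M) \<inter> pverts H)"
proof -
  interpret unmonitored_component G H B M c e
    by (rule unmonitored_component.intro) (fact assms)+
  have "mat_rank (flow_block G c e rs cs H) = dim_col (flow_block G c e rs cs H) \<longleftrightarrow> trivial_kernel"
    by (rule full_rank_iff_trivial_kernel) (fact assms)+
  also have "\<dots> \<longleftrightarrow> hall_condition V E X Y"
    using hall_condition_if_trivial_kernel trivial_kernel_if_hall_condition assms(12,13) by blast
  also have "\<dots> \<longleftrightarrow> (\<forall>S. vertex_cut H X Y S \<longrightarrow> card X \<le> card S)"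
    by (rule hall_condition_iff_vertex_cut) (auto intro: H.pair_fin_digraph)
  also have "\<dots> \<longleftrightarrow> card C = card X"
  proof -
    \<comment> \<open>Every path from \<open>X\<close> starts in \<open>X\<close>, so
      \<open>card C \<le> card X\<close> always holds, and equality says that no cut is smaller than
      \<open>X\<close>.\<close>
    have "vertex_cut H X Y X" by (auto simp: vertex_cut_def vpath_def vwalk_def dest!: hd_in_set)
    moreover have "vertex_cut H X Y C" "\<And>S. vertex_cut H X Y S \<Longrightarrow> card C \<le> card S"
      using assms(11) by (auto simp: minimum_vertex_cut_def is_arg_min_def not_less)
    ultimately show ?thesis by (metis le_antisym)
  qed
  finally show ?thesis .
qed

end
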